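(* Let $\Phi$ be a linear flow on a vector bundle $\pi:\mathcal{V}\to B$ over a compact chain transitive metric space $B$. Let ${}_{\mathbb{S}}M_j$ be a chain recurrent component of the induced flow $\mathbb{S}\Phi$ on the sphere bundle $\mathbb{S}\mathcal{V}$ and let $\mathcal{V}_j^+=\{\alpha v\in\mathcal{V}\mid \alpha>0,\ v\in{}_{\mathbb{S}}M_j\}$ be the cone bundle generated by it. If the Morse spectrum satisfies $0\in\mathrm{int}\left(\Sigma_{Mo}(\mathcal{V}_j^+)\right)$, then the set $\overline{\pi_P\mathcal{V}_j^+}$ is chain transitive on the closed upper hemisphere $\overline{\mathbb{S}_P^+\mathcal{V}}$ of the Poincaré sphere bundle.
   Context: Vector bundle: $H$ is a finite-dimensional real Hilbert space, $B$ a compact metric space, $\mathcal{V}$ a topological space, $\pi:\mathcal{V}\to B$ continuous, with a finite open cover $\{U_a\}_{a\in A}$ of $B$ and homeomorphisms $\varphi_a:\pi^{-1}(U_a)\to U_a\times H$ with $\mathrm{pr}_1\circ\varphi_a=\pi$, such that the transition maps are linear on fibers, i.e. $\varphi_{a'}\circ\varphi_a^{-1}(b,h)=(b,L_{a'a}(b)h)$ with $L_{a'a}(b):H\to H$ linear for $b\in U_a\cap U_{a'}$ (each $\varphi_a$ may be assumed to extend to a homeomorphism $\overline{\pi^{-1}(U_a)}\to\overline{U_a}\times H$). Fibers $\mathcal{V}_b=\pi^{-1}(b)$ are vector spaces via the $\varphi_a$, with the continuous inner product $\langle v,v'\rangle=\sum_{a\in A}d(\pi(v),B\setminus U_a)\langle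 v,v'\rangle_a$ for $\pi(v)=\pi(v')$, where $\langle v,v'\rangle_a=\langle x,x'\rangle_H$ if $v=\varphi_a^{-1}(b,x)$, $v'=\varphi_a^{-1}(b,x')$; $\|\cdot\|$ is the corresponding norm on fibers. Linear flow: a continuous flow $\Phi$ on $\mathcal{V}$ mapping fibers to fibers and linear on fibers. It induces a flow on $B$, and $B$ is assumed chain transitive for this flow. Sphere bundle: $\mathbb{S}\mathcal{V}=\{v\in\mathcal{V}\mid\|v\|=1\}$ (compact), with induced flow $\mathbb{S}\Phi(t,v)=\Phi(t,v)/\|\Phi(t,v)\|$. Chains: for a flow $\Psi$ on a metric space $X$ and $\varepsilon,T>0$, an $(\varepsilon,T)$-chain from $x$ to $y$ is given by $n\in\mathbb{N}$ ($n\ge1$), $T_0,\dots,T_{n-1}\ge T$ and $x_0=x,x_1,\dots,x_n=y\in X$ with $d(\Psi(T_i,x_i),x_{i+1})<\varepsilon$ for $i=0,\dots,n-1$. $\Omega(x)$ is the set of $y\in X$ such that for all $\varepsilon,T>0$ there is an $(\varepsilon,T)$-chain from $x$ to $y$. A set is chain transitive (on $X$) if $y\in\Omega(x)$ for all $x,y$ in the set (chain points may lie anywhere in $X$). A chain recurrent component is a maximal chain transitive set. Morse spectrum: for an $(\varepsilon,T)$-chain $\zeta$ of $\mathbb{S}\Phi$ given by $T_0,\dots,T_{n-1}\ge T$ and $v_0,\dots,v_n\in\mathbb{S}\mathcal{V}$, with total time $\sigma=\sum_{i=0}^{n-1}T_i$, the chain exponent is $\lambda(\zeta)=\frac1\sigma\sum_{i=0}^{n-1}\log\|\Phi(T_i,v_i)\|$.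 $\Sigma_{Mo}(\mathcal{V}_j^+)$ is the set of $\lambda\in\mathbb{R}$ for which there are $\varepsilon^k\to0$, $T^k\to\infty$ and $(\varepsilon^k,T^k)$-chains $\zeta^k$ in ${}_{\mathbb{S}}M_j$ (all chain points in ${}_{\mathbb{S}}M_j$) with $\lambda(\zeta^k)\to\lambda$ as $k\to\infty$. The interior is taken in $\mathbb{R}$. Poincaré sphere bundle: $\mathcal{V}^1=\mathcal{V}\times\mathbb{R}\to B$, $(v,r)\mapsto\pi(v)$, is a vector bundle with fiber $H\times\mathbb{R}$ and trivializations $(v,r)\mapsto(b,(x,r))$ for $(b,x)=\varphi_a(v)$; the fiber norm is $\|(v,r)\|=\sqrt{\|v\|^2+r^2}$. $\mathbb{S}\mathcal{V}^1=\{(v,r)\mid\|(v,r)\|=1\}$ is the Poincaré sphere bundle. The map $\pi_P:\mathcal{V}\to\mathbb{S}\mathcal{V}^1$, $\pi_P(v)=\left(\frac{v}{\|(v,1)\|},\frac{1}{\|(v,1)\|}\right)$, is a homeomorphism onto the open upper hemisphere $\mathbb{S}_P^+\mathcal{V}=\{(v,r)\in\mathbb{S}\mathcal{V}^1\mid r>0\}$; its closure is $\overline{\mathbb{S}_P^+\mathcal{V}}=\{(v,r)\in\mathbb{S}\mathcal{V}^1\mid r\ge0\}$. The linear flow $\Phi^1(t,(v,r))=(\Phi(t,v),r)$ on $\mathcal{V}^1$ induces the flow $\mathbb{S}\Phi^1=\Phi^1/\|\Phi^1\|$ on $\mathbb{S}\mathcal{V}^1$, which leaves $\overline{\mathbb{S}_P^+\mathcal{V}}$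 invariant; chain transitivity refers to this flow. $\mathbb{S}\mathcal{V}$ and $\mathbb{S}\mathcal{V}^1$ are compact metrizable and carry fixed metrics compatible with their topologies (by compactness the notions do not depend on the choice); subsets carry the restricted metrics. *)

theory Defs
  imports "HOL-Analysis.Analysis"
begin

section \<open>Vector bundles given by a finite trivializing cover\<close>

text \<open>The total space is the whole type \<open>'v\<close>, the base the whole type \<open>'b\<close>, and \<open>'h\<close> is the
  fiber; \<open>chart E a\<close> is only relevant on the preimage of \<open>chart_dom E a\<close>.\<close>

record ('v, 'b, 'h, 'i) vbundle =
  proj :: "'v \<Rightarrow> 'b"
  charts :: "'i set"
  chart_dom :: "'i \<Rightarrow> 'b set"
  chart :: "'i \<Rightarrow> 'v \<Rightarrow> 'b \<times> 'h"

definition over :: "('v, 'b, 'h, 'i) vbundle \<Rightarrow> 'i \<Rightarrow> 'v set" where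
  "over E a = proj E -` chart_dom E a"

definition chart_inv :: "('v, 'b, 'h, 'i) vbundle \<Rightarrow> 'i \<Rightarrow> 'b \<times> 'h \<Rightarrow> 'v" where
  "chart_inv E a = inv_into (over E a) (chart E a)"

text \<open>The last conjunct is the standing normalization that the trivializations extend to the
  closures; continuity of the inner product \<open>fiber_inner\<close> below and compactness of the sphere bundle
  depend on it.\<close>

definition vector_bundle ::
  "('v::topological_space, 'b::metric_space, 'h::euclidean_space, 'i) vbundle \<Rightarrow> bool" where
  "vector_bundle E \<longleftrightarrow>
     compact (UNIV :: 'b set) \<and>
     continuous_on UNIV (proj E) \<and>
     finite (charts E) \<and>
     (\<forall>a\<in>charts E. open (chart_dom E a)) \<and>
     (\<Union>a\<in>charts E. chart_dom E a) = UNIV \<and>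
     (\<forall>a\<in>charts E. homeomorphism (over E a) (chart_dom E a \<times> UNIV) (chart E a) (chart_inv E a)) \<and>
     (\<forall>a\<in>charts E. \<forall>v\<in>over E a. fst (chart E a v) = proj E v) \<and>
     (\<forall>a\<in>charts E. \<forall>a'\<in>charts E. \<forall>b\<in>chart_dom E a \<inter> chart_dom E a'.
        \<exists>L. linear L \<and> (\<forall>h. chart E a' (chart_inv E a (b, h)) = (b, L h))) \<and>
     (\<forall>a\<in>charts E. \<exists>f g. homeomorphism (closure (over E a)) (closure (chart_dom E a) \<times> UNIV) f g \<and>
        (\<forall>v\<in>over E a. f v = chart E a v))"

text \<open>The vector space operations of the fibers. They are computed in an arbitrary chart around
  the fiber; in a vector bundle the result does not depend on that chart. \<open>fiber_add E v w\<close> is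
  only meaningful if \<open>v\<close> and \<open>w\<close> lie in the same fiber.\<close>

definition chart_at :: "('v, 'b, 'h, 'i) vbundle \<Rightarrow> 'b \<Rightarrow> 'i" where
  "chart_at E b = (SOME a. a \<in> charts E \<and> b \<in> chart_dom E a)"

definition fiber_add :: "('v, 'b, 'h::real_vector, 'i) vbundle \<Rightarrow> 'v \<Rightarrow> 'v \<Rightarrow> 'v" where
  "fiber_add E v w =
     (let a = chart_at E (proj E v)
      in chart_inv E a (proj E v, snd (chart E a v) + snd (chart E a w)))"

definition fiber_scale :: "('v, 'b, 'h::real_vector, 'i) vbundle \<Rightarrow> real \<Rightarrow> 'v \<Rightarrow> 'v" where
  "fiber_scale E \<alpha> v =
     (let a = chart_at E (proj E v)
      in chart_inv E a (proj E v, \<alpha> *\<^sub>R snd (chart E a v)))"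

text \<open>The library sets \<open>infdist b {} = 0\<close>, which would make the inner product vanish for a
  chart that is defined over all of the base. The distance to the empty set is therefore
  taken to be \<open>1\<close>.\<close>

definition compl_dist :: "'b::metric_space \<Rightarrow> 'b set \<Rightarrow> real" where
  "compl_dist b U = (if U = UNIV then 1 else infdist b (- U))"

text \<open>Only meaningful for \<open>v\<close> and \<open>w\<close> in the same fiber. If this fiber is not over
  \<open>chart_dom E a\<close>, then the summand for \<open>a\<close> has the factor \<open>0\<close>.\<close>

definition fiber_inner ::
  "('v, 'b::metric_space, 'h::real_inner, 'i) vbundle \<Rightarrow> 'v \<Rightarrow> 'v \<Rightarrow> real" where
  "fiber_inner E v w =
     (\<Sum>a\<in>charts E. compl_dist (proj E v) (chart_dom E a) * (snd (chart E a v) \<bullet> snd (chart E a w)))"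

definition fiber_norm :: "('v, 'b::metric_space, 'h::real_inner, 'i) vbundle \<Rightarrow> 'v \<Rightarrow> real" where
  "fiber_norm E v = sqrt (fiber_inner E v v)"


section \<open>Linear flows\<close>

definition continuous_flow :: "(real \<Rightarrow> 'v \<Rightarrow> 'v::topological_space) \<Rightarrow> bool" where
  "continuous_flow \<Phi> \<longleftrightarrow>
     continuous_on UNIV (\<lambda>(t, v). \<Phi> t v) \<and>
     (\<forall>v. \<Phi> 0 v = v) \<and>
     (\<forall>s t v. \<Phi> (s + t) v = \<Phi> s (\<Phi> t v))"

definition linear_flow ::
  "('v::topological_space, 'b, 'h::real_vector, 'i) vbundle \<Rightarrow> (real \<Rightarrow> 'v \<Rightarrow> 'v) \<Rightarrow> bool" where
  "linear_flow E \<Phi> \<longleftrightarrow>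
     continuous_flow \<Phi> \<and>
     (\<forall>t v w. proj E v = proj E w \<longrightarrow> proj E (\<Phi> t v) = proj E (\<Phi> t w)) \<and>
     (\<forall>t v w. proj E v = proj E w \<longrightarrow> \<Phi> t (fiber_add E v w) = fiber_add E (\<Phi> t v) (\<Phi> t w)) \<and>
     (\<forall>t \<alpha> v. \<Phi> t (fiber_scale E \<alpha> v) = fiber_scale E \<alpha> (\<Phi> t v))"

definition base_flow :: "('v, 'b, 'h, 'i) vbundle \<Rightarrow> (real \<Rightarrow> 'v \<Rightarrow> 'v) \<Rightarrow> real \<Rightarrow> 'b \<Rightarrow> 'b" where
  "base_flow E \<Phi> t b = (THE c. \<exists>v. proj E v = b \<and> proj E (\<Phi> t v) = c)"

text \<open>The norm on the fibers is a parameter \<open>N\<close> of the sphere bundle and its flow, because the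
  norm used on the Poincare bundle is not the one obtained from its charts.\<close>

definition sphere_bundle :: "('v \<Rightarrow> real) \<Rightarrow> 'v set" where
  "sphere_bundle N = {v. N v = 1}"

definition sphere_flow ::
  "('v, 'b, 'h::real_vector, 'i) vbundle \<Rightarrow> ('v \<Rightarrow> real) \<Rightarrow> (real \<Rightarrow> 'v \<Rightarrow> 'v) \<Rightarrow> real \<Rightarrow> 'v \<Rightarrow> 'v" where
  "sphere_flow E N \<Phi> t v = fiber_scale E (1 / N (\<Phi> t v)) (\<Phi> t v)"


section \<open>Chains\<close>

text \<open>The space is a set \<open>X\<close> with a metric \<open>d\<close>. A chain consists of its length \<open>n\<close>, the times
  \<open>\<tau> 0, \<dots>, \<tau> (n - 1)\<close> and the points \<open>x 0, \<dots>, x n\<close>; all other values of \<open>\<tau>\<close> and \<open>x\<close> are ignored.\<close>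

definition is_chain ::
  "'x set \<Rightarrow> ('x \<Rightarrow> 'x \<Rightarrow> real) \<Rightarrow> (real \<Rightarrow> 'x \<Rightarrow> 'x) \<Rightarrow> real \<Rightarrow> real \<Rightarrow>
   nat \<Rightarrow> (nat \<Rightarrow> real) \<Rightarrow> (nat \<Rightarrow> 'x) \<Rightarrow> bool" where
  "is_chain X d \<Psi> \<epsilon> T n \<tau> x \<longleftrightarrow>
     \<epsilon> > 0 \<and> T > 0 \<and> n \<ge> 1 \<and>
     (\<forall>i<n. \<tau> i \<ge> T) \<and>
     (\<forall>i\<le>n. x i \<in> X) \<and>
     (\<forall>i<n. d (\<Psi> (\<tau> i) (x i)) (x (Suc i)) < \<epsilon>)"

definition chain_limit_set ::
  "'x set \<Rightarrow> ('x \<Rightarrow> 'x \<Rightarrow> real) \<Rightarrow> (real \<Rightarrow> 'x \<Rightarrow> 'x) \<Rightarrow> 'x \<Rightarrow> 'x set" where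
  "chain_limit_set X d \<Psi> x =
     {y \<in> X. \<forall>\<epsilon>>0. \<forall>T>0. \<exists>n \<tau> c. is_chain X d \<Psi> \<epsilon> T n \<tau> c \<and> c 0 = x \<and> c n = y}"

definition chain_transitive ::
  "'x set \<Rightarrow> ('x \<Rightarrow> 'x \<Rightarrow> real) \<Rightarrow> (real \<Rightarrow> 'x \<Rightarrow> 'x) \<Rightarrow> 'x set \<Rightarrow> bool" where
  "chain_transitive X d \<Psi> Y \<longleftrightarrow> Y \<subseteq> X \<and> (\<forall>x\<in>Y. \<forall>y\<in>Y. y \<in> chain_limit_set X d \<Psi> x)"

definition chain_recurrent_component ::
  "'x set \<Rightarrow> ('x \<Rightarrow> 'x \<Rightarrow> real) \<Rightarrow> (real \<Rightarrow> 'x \<Rightarrow> 'x) \<Rightarrow> 'x set \<Rightarrow> bool" where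
  "chain_recurrent_component X d \<Psi> M \<longleftrightarrow>
     chain_transitive X d \<Psi> M \<and> (\<forall>Y. chain_transitive X d \<Psi> Y \<and> M \<subseteq> Y \<longrightarrow> Y = M)"


section \<open>Morse spectrum\<close>

definition chain_exponent ::
  "('v \<Rightarrow> real) \<Rightarrow> (real \<Rightarrow> 'v \<Rightarrow> 'v) \<Rightarrow> nat \<Rightarrow> (nat \<Rightarrow> real) \<Rightarrow> (nat \<Rightarrow> 'v) \<Rightarrow> real" where
  "chain_exponent N \<Phi> n \<tau> x = (\<Sum>i<n. ln (N (\<Phi> (\<tau> i) (x i)))) / (\<Sum>i<n. \<tau> i)"

text \<open>\<open>d\<close> is the metric on the sphere bundle of \<open>E\<close> and \<open>M\<close> a subset of the sphere bundle.\<close>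

definition morse_spectrum ::
  "('v, 'b::metric_space, 'h::real_inner, 'i) vbundle \<Rightarrow> (real \<Rightarrow> 'v \<Rightarrow> 'v) \<Rightarrow>
   ('v \<Rightarrow> 'v \<Rightarrow> real) \<Rightarrow> 'v set \<Rightarrow> real set" where
  "morse_spectrum E \<Phi> d M =
     {l. \<exists>(\<epsilon> :: nat \<Rightarrow> real) (T :: nat \<Rightarrow> real) n \<tau> x.
        \<epsilon> \<longlonglongrightarrow> 0 \<and> filterlim T at_top sequentially \<and>
        (\<forall>k. is_chain (sphere_bundle (fiber_norm E)) d (sphere_flow E (fiber_norm E) \<Phi>)
               (\<epsilon> k) (T k) (n k) (\<tau> k) (x k)) \<and>
        (\<forall>k. \<forall>i\<le>n k. x k i \<in> M) \<and>
        (\<lambda>k. chain_exponent (fiber_norm E) \<Phi> (n k) (\<tau> k) (x k)) \<longlonglongrightarrow> l}"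

definition cone_bundle :: "('v, 'b, 'h::real_vector, 'i) vbundle \<Rightarrow> 'v set \<Rightarrow> 'v set" where
  "cone_bundle E M = {fiber_scale E \<alpha> v | \<alpha> v. \<alpha> > 0 \<and> v \<in> M}"


section \<open>The Poincare sphere bundle\<close>

definition poincare_bundle ::
  "('v, 'b, 'h, 'i) vbundle \<Rightarrow> ('v \<times> real, 'b, 'h \<times> real, 'i) vbundle" where
  "poincare_bundle E =
     \<lparr> proj = (\<lambda>(v, r). proj E v),
       charts = charts E,
       chart_dom = chart_dom E,
       chart = (\<lambda>a (v, r). (fst (chart E a v), (snd (chart E a v), r))) \<rparr>"

definition poincare_norm ::
  "('v, 'b::metric_space, 'h::real_inner, 'i) vbundle \<Rightarrow> 'v \<times> real \<Rightarrow> real" where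
  "poincare_norm E = (\<lambda>(v, r). sqrt ((fiber_norm E v)\<^sup>2 + r\<^sup>2))"

definition poincare_sphere ::
  "('v, 'b::metric_space, 'h::real_inner, 'i) vbundle \<Rightarrow> ('v \<times> real) set" where
  "poincare_sphere E = sphere_bundle (poincare_norm E)"

definition closed_upper_hemisphere ::
  "('v, 'b::metric_space, 'h::real_inner, 'i) vbundle \<Rightarrow> ('v \<times> real) set" where
  "closed_upper_hemisphere E = {(v, r) \<in> poincare_sphere E. r \<ge> 0}"

definition poincare_flow ::
  "('v, 'b::metric_space, 'h::real_inner, 'i) vbundle \<Rightarrow> (real \<Rightarrow> 'v \<Rightarrow> 'v) \<Rightarrow>
   real \<Rightarrow> 'v \<times> real \<Rightarrow> 'v \<times> real" where
  "poincare_flow E \<Phi> =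
     sphere_flow (poincare_bundle E) (poincare_norm E) (\<lambda>t (v, r). (\<Phi> t v, r))"

definition poincare_proj ::
  "('v, 'b::metric_space, 'h::real_inner, 'i) vbundle \<Rightarrow> 'v \<Rightarrow> 'v \<times> real" where
  "poincare_proj E v =
     (fiber_scale E (1 / poincare_norm E (v, 1)) v, 1 / poincare_norm E (v, 1))"

end

theory Submission
  imports Defs
begin

text \<open>In the coordinates \<open>\<rho> v\<close> with \<open>v\<close> in the sphere bundle and \<open>\<rho> > 0\<close>, an \<open>(\<epsilon>, T)\<close>-chain of the
  sphere flow with growth \<open>g\<close> (the sum of the logarithms in the chain exponent) lifts to a chain in
  the hemisphere that changes \<open>ln \<rho>\<close> by exactly \<open>g\<close>. As the Morse spectrum contains exponents of
  both signs, any two points \<open>p\<close>, \<open>q\<close> of the component are joined by chains of arbitrarily negative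
  and by chains of arbitrarily positive growth. To go from \<open>\<rho> p\<close> to \<open>\<rho>' q\<close>, descend along a chain
  from \<open>p\<close> to \<open>p\<close> until \<open>\<rho>\<close> is tiny, where all radii are close to each other in the Poincare
  sphere, jump to the radius \<open>\<rho>' exp (- h)\<close>, and ascend along a chain from \<open>p\<close> to \<open>q\<close> of large
  growth \<open>h\<close>. Chain transitivity passes to the closure by continuity of the flow.\<close>

section \<open>Chains in metric spaces\<close>

text \<open>Preimages of the balls of radius \<open>\<epsilon> / 2\<close> cover \<open>X\<close>,
  and a Lebesgue number of this cover serves as \<open>\<delta>\<close>: two points in one member
  have images within \<open>\<epsilon> / 2\<close> of a common centre.\<close>

lemma Heine_Cantor_metric:
  assumes "Metric_space X d" "Metric_space Y e"
    and compact: "compact_space (Metric_space.mtopology X d)"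
    and f: "continuous_map (Metric_space.mtopology X d) (Metric_space.mtopology Y e) f"
    and "0 < \<epsilon>"
  obtains \<delta> where "0 < \<delta>" "\<And>x y. \<lbrakk>x \<in> X; y \<in> X; d x y < \<delta>\<rbrakk> \<Longrightarrow> e (f x) (f y) < \<epsilon>"
proof -
  interpret X: Metric_space X d by fact
  interpret Y: Metric_space Y e by fact
  let ?U = "\<lambda>x. {y \<in> X. f y \<in> Y.mball (f x) (\<epsilon> / 2)}"
  have fX: "f x \<in> Y" if "x \<in> X" for x
    using f that by (auto simp: continuous_map_def)
  have "openin X.mtopology (?U x)" for x
    using openin_continuous_map_preimage[OF f Y.openin_mball, of "f x" "\<epsilon> / 2"] by simp
  moreover have "X \<subseteq> \<Union>(?U ` X)"
    using fX \<open>0 < \<epsilon>\<close> by auto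
  ultimately obtain \<delta> where \<delta>: "0 < \<delta>" "\<And>x. x \<in> X \<Longrightarrow> \<exists>z\<in>X. X.mball x \<delta> \<subseteq> ?U z"
    using X.lebesgue_number[of X "?U ` X"] compact unfolding compact_space_def X.topspace_mtopology
    by (smt (verit) imageE)
  show ?thesis
  proof
    fix x y assume xy: "x \<in> X" "y \<in> X" "d x y < \<delta>"
    obtain z where z: "z \<in> X" "X.mball x \<delta> \<subseteq> ?U z" using \<delta>(2)[OF xy(1)] by auto
    have "x \<in> X.mball x \<delta>" "y \<in> X.mball x \<delta>" using xy \<delta>(1) by auto
    then have "x \<in> ?U z" "y \<in> ?U z" using z(2) by blast+
    then have "e (f z) (f x) < \<epsilon> / 2" "e (f z) (f y) < \<epsilon> / 2" by simp_all
    then show "e (f x) (f y) < \<epsilon>"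
      using Y.triangle'[of "f x" "f z" "f y"] Y.triangle[OF fX fX fX, OF xy(1) z(1) xy(2)]
        Y.commute[of "f x" "f z"] by linarith
  qed (fact \<delta>(1))
qed

text \<open>Chains that carry along the sum \<open>g\<close> of the weights \<open>w (\<tau> i) (x i)\<close>. For the weight
  \<open>\<lambda>t v. ln \<parallel>\<Phi> t v\<parallel>\<close> this is the numerator of the chain exponent.\<close>

inductive chain_to :: "'x set \<Rightarrow> ('x \<Rightarrow> 'x \<Rightarrow> real) \<Rightarrow> (real \<Rightarrow> 'x \<Rightarrow> 'x) \<Rightarrow> (real \<Rightarrow> 'x \<Rightarrow> real) \<Rightarrow>
    real \<Rightarrow> real \<Rightarrow> 'x \<Rightarrow> 'x \<Rightarrow> real \<Rightarrow> bool"
  for X d \<Psi> w \<epsilon> T x where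
  single: "\<lbrakk>x \<in> X; y \<in> X; T \<le> t; d (\<Psi> t x) y < \<epsilon>\<rbrakk> \<Longrightarrow> chain_to X d \<Psi> w \<epsilon> T x y (w t x)"
| snoc: "\<lbrakk>chain_to X d \<Psi> w \<epsilon> T x y g; z \<in> X; T \<le> t; d (\<Psi> t y) z < \<epsilon>\<rbrakk>
    \<Longrightarrow> chain_to X d \<Psi> w \<epsilon> T x z (g + w t y)"

section \<open>Concatenation and perturbation of weighted chains\<close>

lemma chain_to_in_space: "chain_to X d \<Psi> w \<epsilon> T x y g \<Longrightarrow> x \<in> X \<and> y \<in> X"
  by (induction rule: chain_to.induct) auto

lemma chain_to_trans:
  assumes "chain_to X d \<Psi> w \<epsilon> T y z h" "chain_to X d \<Psi> w \<epsilon> T x y g"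
  shows "chain_to X d \<Psi> w \<epsilon> T x z (g + h)"
  using assms
proof (induction rule: chain_to.induct)
  case (snoc u h z t)
  then show ?case using chain_to.snoc[of X d \<Psi> w \<epsilon> T x u "g + h" z t] by (simp add: add.assoc)
qed (rule chain_to.snoc)

lemma chain_to_mono:
  assumes "chain_to X d \<Psi> w \<epsilon> T x y g" "\<epsilon> \<le> \<epsilon>'" "T' \<le> T"
  shows "chain_to X d \<Psi> w \<epsilon>' T' x y g"
  using assms(1)
proof induction
  case (single y t)
  then show ?case using assms(2,3) by (intro chain_to.single) auto
next
  case (snoc y g z t)
  then show ?case using assms(2,3) by (intro chain_to.snoc) auto
qed

text \<open>Only the last jump sees the end point, so the slack
  \<open>\<epsilon>' - \<epsilon>\<close> is spent there by the triangle inequality; times and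
  growth are unchanged.\<close>

lemma chain_to_perturb:
  assumes "Metric_space X d" and inv: "\<And>t x. x \<in> X \<Longrightarrow> \<Psi> t x \<in> X"
    and c: "chain_to X d \<Psi> w \<epsilon> T x y g" and z: "z \<in> X" "d y z \<le> \<epsilon>' - \<epsilon>"
  shows "chain_to X d \<Psi> w \<epsilon>' T x z g"
proof -
  interpret Metric_space X d by fact
  have le: "\<epsilon> \<le> \<epsilon>'" using z nonneg[of y z] by linarith
  have *: "d (\<Psi> t u) z < \<epsilon>'" if "u \<in> X" "d (\<Psi> t u) y < \<epsilon>" "y \<in> X" for t u
    using triangle[OF inv[OF that(1)] that(3) z(1), of t] that z by simp
  show ?thesis
    using c
  proof cases
    case (single t)
    then show ?thesis using * z by (auto intro!: chain_to.single)
  next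
    case (snoc u h t)
    have "chain_to X d \<Psi> w \<epsilon>' T x z (h + w t u)"
      using snoc * z chain_to_in_space[OF snoc(2)]
      by (intro chain_to.snoc[OF chain_to_mono[OF snoc(2) le order_refl]]) auto
    then show ?thesis using snoc by simp
  qed
qed

lemma chain_to_imp_is_chain:
  assumes "chain_to X d \<Psi> w \<epsilon> T x y g" "0 < \<epsilon>" "0 < T"
  shows "\<exists>n \<tau> c. is_chain X d \<Psi> \<epsilon> T n \<tau> c \<and> c 0 = x \<and> c n = y \<and> (\<Sum>i<n. w (\<tau> i) (c i)) = g"
  using assms(1)
proof induction
  case (single y t)
  have "is_chain X d \<Psi> \<epsilon> T 1 (\<lambda>_. t) (\<lambda>i. if i = 0 then x else y)"
    using single assms by (auto simp: is_chain_def)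
  then show ?case by (intro exI[of _ 1] exI[of _ "\<lambda>_. t"] exI[of _ "\<lambda>i. if i = 0 then x else y"]) auto
next
  case (snoc y g z t)
  then obtain n \<tau> c where c: "is_chain X d \<Psi> \<epsilon> T n \<tau> c" "c 0 = x" "c n = y" "(\<Sum>i<n. w (\<tau> i) (c i)) = g"
    by auto
  define \<tau>' where "\<tau>' = \<tau>(n := t)"
  define c' where "c' = c(Suc n := z)"
  have "is_chain X d \<Psi> \<epsilon> T (Suc n) \<tau>' c'"
    using c snoc by (auto simp: is_chain_def less_Suc_eq le_Suc_eq \<tau>'_def c'_def)
  moreover have "(\<Sum>i<n. w (\<tau>' i) (c' i)) = (\<Sum>i<n. w (\<tau> i) (c i))"
    by (rule sum.cong) (auto simp: \<tau>'_def c'_def)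
  moreover have "c' 0 = x" "c' (Suc n) = z" "\<tau>' n = t" "c' n = y"
    using c by (auto simp: \<tau>'_def c'_def)
  ultimately show ?case
    using c(4) by (intro exI[of _ "Suc n"] exI[of _ \<tau>'] exI[of _ c']) simp
qed

lemma is_chain_imp_chain_to:
  assumes "is_chain X d \<Psi> \<epsilon> T n \<tau> c"
  shows "chain_to X d \<Psi> w \<epsilon> T (c 0) (c n) (\<Sum>i<n. w (\<tau> i) (c i))"
proof -
  \<comment> \<open>The induction is over chains of length \<open>Suc m\<close>, since a chain has
    at least one jump.\<close>
  have "chain_to X d \<Psi> w \<epsilon> T (c 0) (c (Suc m)) (\<Sum>i<Suc m. w (\<tau> i) (c i))" if "Suc m \<le> n" for m
    using that
  proof (induction m)
    case 0
    then show ?case using assms chain_to.single[of "c 0" X "c (Suc 0)" T "\<tau> 0" d \<Psi> \<epsilon> w] by (auto simp: is_chain_def)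
  next
    case (Suc m)
    then have "chain_to X d \<Psi> w \<epsilon> T (c 0) (c (Suc m)) (\<Sum>i<Suc m. w (\<tau> i) (c i))" by simp
    from chain_to.snoc[OF this, of "c (Suc (Suc m))" "\<tau> (Suc m)"] show ?case
      using assms Suc.prems by (simp add: is_chain_def)
  qed
  from this[of "n - 1"] show ?thesis using assms by (simp add: is_chain_def)
qed

text \<open>The weight is free because the growth is quantified away. The sphere bundle can thus use
  \<open>log_growth\<close> and the hemisphere the weight zero.\<close>

lemma chain_limit_set_iff:
  "y \<in> chain_limit_set X d \<Psi> x \<longleftrightarrow> y \<in> X \<and> (\<forall>\<epsilon>>0. \<forall>T>0. \<exists>g. chain_to X d \<Psi> w \<epsilon> T x y g)"
proof -
  have "(\<exists>n \<tau> c. is_chain X d \<Psi> \<epsilon> T n \<tau> c \<and> c 0 = x \<and> c n = y) \<longleftrightarrow> (\<exists>g. chain_to X d \<Psi> w \<epsilon> T x y g)"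
    if "0 < \<epsilon>" "0 < T" for \<epsilon> T
    using chain_to_imp_is_chain[OF _ that, of X d \<Psi> w x y] is_chain_imp_chain_to[of X d \<Psi> \<epsilon> T _ _ _ w]
    by blast
  then show ?thesis unfolding chain_limit_set_def by simp
qed

section \<open>Chain transitivity of closures\<close>

lemma chain_to_shift_start:
  assumes c: "chain_to X d \<Psi> w \<epsilon> (2 * T) x y g" and "0 < T" "\<Psi> T x \<in> X"
    and semi: "\<And>s t. \<Psi> (s + t) x = \<Psi> s (\<Psi> t x)"
  shows "\<exists>g. chain_to X d \<Psi> w \<epsilon> T (\<Psi> T x) y g"
  using c
proof induction
  case (single y t)
  \<comment> \<open>The first jump lasts at least \<open>2 * T\<close>, so at least \<open>T\<close>
    remains after its first \<open>T\<close> time units are cut off.\<close>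
  then show ?case
    using chain_to.single[OF assms(3) single(2), of T "t - T" d \<Psi> \<epsilon> w] semi[of "t - T" T] by auto
next
  case (snoc y g z t)
  then obtain h where "chain_to X d \<Psi> w \<epsilon> T (\<Psi> T x) y h" by blast
  from chain_to.snoc[OF this snoc(2) _ snoc(4)] show ?case using snoc(3) \<open>0 < T\<close> by auto
qed

text \<open>Approximate \<open>x\<close> and \<open>y\<close> by \<open>x'\<close> and
  \<open>y'\<close> in \<open>Y\<close>. The end of a chain from \<open>x'\<close> to
  \<open>y'\<close> is moved to \<open>y\<close> by perturbation. At the start, continuity of
  \<open>\<Psi> T\<close> allows a jump of duration \<open>T\<close> from \<open>x\<close> to
  \<open>\<Psi> T x'\<close>, where the chain with its first \<open>T\<close> time units removed
  takes over.\<close>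

lemma chain_transitive_closure:
  assumes PX: "Metric_space P d" and XP: "X \<subseteq> P" and "Y \<subseteq> X"
    and inv: "\<And>t x. x \<in> X \<Longrightarrow> \<Psi> t x \<in> X"
    and semi: "\<And>s t x. x \<in> X \<Longrightarrow> \<Psi> (s + t) x = \<Psi> s (\<Psi> t x)"
    and cont: "\<And>t. continuous_map (Metric_space.mtopology P d) (Metric_space.mtopology P d) (\<Psi> t)"
    and trans: "chain_transitive X d \<Psi> Y"
    and closed: "Metric_space.mtopology P d closure_of Y \<subseteq> X"
  shows "chain_transitive X d \<Psi> (Metric_space.mtopology P d closure_of Y)"
proof -
  interpret P: Metric_space P d by fact
  have X: "Metric_space X d" using P.subspace XP by blast
  let ?w = "\<lambda>_ _. 0"
  have "\<exists>g. chain_to X d \<Psi> ?w \<epsilon> T x y g"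
    if x: "x \<in> P.mtopology closure_of Y" and y: "y \<in> P.mtopology closure_of Y"
      and \<epsilon>: "0 < \<epsilon>" and T: "0 < T" for x y \<epsilon> T
  proof -
    have xX: "x \<in> X" and yX: "y \<in> X" using x y closed by auto
    have xP: "x \<in> P" using xX XP by (rule subsetD[rotated])
    have "\<forall>a\<in>P. \<forall>\<epsilon>>0. \<exists>\<delta>>0. \<forall>z. z \<in> P \<and> d a z < \<delta> \<longrightarrow> d (\<Psi> T a) (\<Psi> T z) < \<epsilon>"
      using P.metric_continuous_map[OF PX, THEN iffD1, OF cont[of T]] by (rule conjunct2)
    from this[rule_format, OF xP \<epsilon>] obtain \<delta>
      where \<delta>: "0 < \<delta>" "\<And>z. z \<in> P \<Longrightarrow> d x z < \<delta> \<Longrightarrow> d (\<Psi> T x) (\<Psi> T z) < \<epsilon>"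
      by auto
    have near: "\<exists>y\<in>Y. d x y < r" if "x \<in> P.mtopology closure_of Y" "0 < r" for x r
      using that by (auto simp: P.metric_closure_of)
    obtain x' where x': "x' \<in> Y" "d x x' < \<delta>" using near[OF x \<delta>(1)] by blast
    obtain y' where y': "y' \<in> Y" "d y y' < \<epsilon> / 2" using near[OF y, of "\<epsilon> / 2"] \<epsilon> by auto
    have x'X: "x' \<in> X" using x' \<open>Y \<subseteq> X\<close> by auto
    have "y' \<in> chain_limit_set X d \<Psi> x'"
      using trans x' y' by (auto simp: chain_transitive_def)
    moreover have "0 < \<epsilon> / 2" "0 < 2 * T" using \<epsilon> T by auto
    ultimately obtain g where "chain_to X d \<Psi> ?w (\<epsilon> / 2) (2 * T) x' y' g"
      using chain_limit_set_iff[of y' X d \<Psi> x' ?w] by meson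
    then have "chain_to X d \<Psi> ?w \<epsilon> (2 * T) x' y g"
      using y' yX P.commute[of y y'] by - (rule chain_to_perturb[OF X inv], auto)
    from chain_to_shift_start[OF this T inv[OF x'X] semi[OF x'X]]
    obtain h where "chain_to X d \<Psi> ?w \<epsilon> T (\<Psi> T x') y h" ..
    moreover have "chain_to X d \<Psi> ?w \<epsilon> T x (\<Psi> T x') 0"
      using chain_to.single[of x X "\<Psi> T x'" T T d \<Psi> \<epsilon> ?w] xX inv[OF x'X] \<delta>(2)[of x'] x' x'X XP by auto
    ultimately show ?thesis by (intro exI) (rule chain_to_trans)
  qed
  then show ?thesis
    using closed by (auto simp: chain_transitive_def chain_limit_set_iff[where w = ?w])
qed


section \<open>Vector bundles\<close>

lemma compl_dist_nonneg [simp]: "0 \<le> compl_dist b U"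
  by (simp add: compl_dist_def infdist_nonneg)

lemma compl_dist_eq_0: "b \<notin> U \<Longrightarrow> compl_dist b U = 0"
  by (auto simp: compl_dist_def)

lemma compl_dist_pos: "open U \<Longrightarrow> b \<in> U \<Longrightarrow> 0 < compl_dist b U"
  using in_closed_iff_infdist_zero[of "- U" b] infdist_nonneg[of b "- U"]
  by (auto simp: compl_dist_def closed_def less_le)

lemma continuous_compl_dist: "continuous_on S (\<lambda>b. compl_dist b U)"
  unfolding compl_dist_def by (cases "U = UNIV") (auto intro!: continuous_intros)

section \<open>Charts and scalar multiplication in the fibers\<close>

locale vec_bundle =
  fixes E :: "('v::topological_space, 'b::metric_space, 'h::euclidean_space, 'i) vbundle"
  assumes vb: "vector_bundle E"
begin

lemma compact_base: "compact (UNIV :: 'b set)"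
  and cont_proj: "continuous_on UNIV (proj E)"
  and finite_charts: "finite (charts E)"
  and open_dom: "a \<in> charts E \<Longrightarrow> open (chart_dom E a)"
  and ex_chart: "\<exists>a\<in>charts E. b \<in> chart_dom E a"
  and chart_homeo: "a \<in> charts E \<Longrightarrow>
    homeomorphism (over E a) (chart_dom E a \<times> UNIV) (chart E a) (chart_inv E a)"
  and chart_extends: "a \<in> charts E \<Longrightarrow>
    \<exists>f g. homeomorphism (closure (over E a)) (closure (chart_dom E a) \<times> UNIV) f g \<and>
          (\<forall>v\<in>over E a. f v = chart E a v)"
  and fst_chart: "a \<in> charts E \<Longrightarrow> proj E v \<in> chart_dom E a \<Longrightarrow> fst (chart E a v) = proj E v"
  and transition: "\<lbrakk>a \<in> charts E; a' \<in> charts E; b \<in> chart_dom E a; b \<in> chart_dom E a'\<rbrakk> \<Longrightarrow>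
    \<exists>L. linear L \<and> (\<forall>h. chart E a' (chart_inv E a (b, h)) = (b, L h))"
  using vb unfolding vector_bundle_def over_def by auto

lemma chart_inv_chart [simp]:
  "a \<in> charts E \<Longrightarrow> proj E v \<in> chart_dom E a \<Longrightarrow> chart_inv E a (chart E a v) = v"
  using homeomorphism_apply1[OF chart_homeo] by (auto simp: over_def)

lemma chart_chart_inv [simp]:
  "a \<in> charts E \<Longrightarrow> b \<in> chart_dom E a \<Longrightarrow> chart E a (chart_inv E a (b, h)) = (b, h)"
  using homeomorphism_apply2[OF chart_homeo] by auto

lemma proj_chart_inv [simp]:
  assumes "a \<in> charts E" "b \<in> chart_dom E a"
  shows "proj E (chart_inv E a (b, h)) = b"
proof -
  have "chart_inv E a (b, h) \<in> over E a"
    using homeomorphism_image2[OF chart_homeo[OF assms(1)]] assms(2) by auto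
  then show ?thesis
    using fst_chart[OF assms(1), of "chart_inv E a (b, h)"] chart_chart_inv[OF assms] by (simp add: over_def)
qed

lemma chart_eq_iff:
  assumes "a \<in> charts E" "proj E v \<in> chart_dom E a"
  shows "chart E a v = (proj E v, snd (chart E a v))"
  using fst_chart[OF assms] by (metis prod.collapse)

lemma chart_at: "chart_at E b \<in> charts E" "b \<in> chart_dom E (chart_at E b)"
  using someI_ex[of "\<lambda>a. a \<in> charts E \<and> b \<in> chart_dom E a"] ex_chart[of b]
  unfolding chart_at_def by auto

text \<open>Transition maps are linear and so commute with scalar multiplication; hence the choice
  made by \<open>chart_at\<close> can be replaced by any chart around the fiber.\<close>

lemma fiber_scale_chart:
  assumes a: "a \<in> charts E" "proj E v \<in> chart_dom E a"
  shows "fiber_scale E \<alpha> v = chart_inv E a (proj E v, \<alpha> *\<^sub>R snd (chart E a v))"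
proof -
  let ?b = "proj E v"
  define c where "c = chart_at E ?b"
  have c: "c \<in> charts E" "?b \<in> chart_dom E c" using chart_at unfolding c_def by auto
  let ?w = "chart_inv E c (?b, \<alpha> *\<^sub>R snd (chart E c v))"
  obtain L where L: "linear L" "\<And>h. chart E a (chart_inv E c (?b, h)) = (?b, L h)"
    using transition[OF c(1) a(1) c(2) a(2)] by auto
  have "chart E a v = (?b, L (snd (chart E c v)))"
    using L(2)[of "snd (chart E c v)"] chart_eq_iff[OF c] chart_inv_chart[OF c] by simp
  then have "chart E a ?w = (?b, \<alpha> *\<^sub>R snd (chart E a v))"
    using L linear_scale[OF L(1)] by simp
  moreover have "proj E ?w = ?b" using c by simp
  ultimately have "?w = chart_inv E a (?b, \<alpha> *\<^sub>R snd (chart E a v))"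
    using chart_inv_chart[OF a(1), of ?w] a(2) by simp
  then show ?thesis by (simp add: fiber_scale_def Let_def c_def)
qed

lemma proj_scale [simp]: "proj E (fiber_scale E \<alpha> v) = proj E v"
  using chart_at by (simp add: fiber_scale_def Let_def)

lemma chart_scale:
  assumes "a \<in> charts E" "proj E v \<in> chart_dom E a"
  shows "snd (chart E a (fiber_scale E \<alpha> v)) = \<alpha> *\<^sub>R snd (chart E a v)"
  using assms by (simp add: fiber_scale_chart)

lemma scale_scale [simp]: "fiber_scale E \<alpha> (fiber_scale E \<beta> v) = fiber_scale E (\<alpha> * \<beta>) v"
proof -
  obtain a where a: "a \<in> charts E" "proj E v \<in> chart_dom E a" using ex_chart by auto
  show ?thesis
    using fiber_scale_chart[OF a(1), of "fiber_scale E \<beta> v" \<alpha>] fiber_scale_chart[OF a, of "\<alpha> * \<beta>"]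
      chart_scale[OF a, of \<beta>] a by simp
qed

lemma scale_one [simp]: "fiber_scale E 1 v = v"
proof -
  obtain a where a: "a \<in> charts E" "proj E v \<in> chart_dom E a" using ex_chart by auto
  show ?thesis
    using fiber_scale_chart[OF a, of 1] chart_eq_iff[OF a] chart_inv_chart[OF a] by simp
qed

text \<open>\<open>chart_at\<close> may jump with the base point. On each open set
  \<open>over E a\<close> the fixed chart \<open>a\<close> gives a continuous formula instead, and
  these sets cover the bundle.\<close>

lemma continuous_fiber_scale: "continuous_on UNIV (\<lambda>(\<alpha>, v). fiber_scale E \<alpha> v)"
proof -
  have "continuous_on (\<Union>a\<in>charts E. UNIV \<times> over E a) (\<lambda>(\<alpha>, v). fiber_scale E \<alpha> v)"
  proof (rule continuous_on_open_UN)
    fix a assume a: "a \<in> charts E"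
    show "open ((UNIV :: real set) \<times> over E a)"
      using open_dom[OF a] cont_proj unfolding over_def
      by (intro open_Times open_vimage) auto
    have c1: "continuous_on (over E a) (chart E a)"
      using chart_homeo[OF a] by (auto simp: homeomorphism_def)
    have c2: "continuous_on (chart_dom E a \<times> UNIV) (chart_inv E a)"
      using chart_homeo[OF a] by (auto simp: homeomorphism_def)
    have "continuous_on (UNIV \<times> over E a) 
      (\<lambda>p :: real \<times> 'v. chart_inv E a (proj E (snd p), fst p *\<^sub>R snd (chart E a (snd p))))"
      by (rule continuous_on_compose2[OF c2])
         (auto intro!: continuous_intros continuous_on_compose2[OF c1] continuous_on_compose2[OF cont_proj]
           simp: over_def)
    then show "continuous_on (UNIV \<times> over E a) (\<lambda>(\<alpha>, v). fiber_scale E \<alpha> v)"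
      by (rule continuous_on_eq) (auto simp: over_def fiber_scale_chart[OF a])
  qed
  moreover have "(\<Union>a\<in>charts E. (UNIV :: real set) \<times> over E a) = UNIV"
    using ex_chart by (auto simp: over_def)
  ultimately show ?thesis by simp
qed

section \<open>The fiber norm and compactness of the sphere bundle\<close>

lemma norm_sq: "(fiber_norm E v)\<^sup>2 =
    (\<Sum>a\<in>charts E. compl_dist (proj E v) (chart_dom E a) * (norm (snd (chart E a v)))\<^sup>2)"
  unfolding fiber_norm_def fiber_inner_def
  by (simp add: sum_nonneg power2_norm_eq_inner)

lemma fiber_norm_nonneg [simp]: "0 \<le> fiber_norm E v"
  unfolding fiber_norm_def fiber_inner_def by (simp add: sum_nonneg)

lemma norm_sq_ge:
  assumes "a \<in> charts E"
  shows "compl_dist (proj E v) (chart_dom E a) * (norm (snd (chart E a v)))\<^sup>2 \<le> (fiber_norm E v)\<^sup>2"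
  unfolding norm_sq using finite_charts assms
  by (intro member_le_sum) auto

lemma norm_scale [simp]: "fiber_norm E (fiber_scale E \<alpha> v) = \<bar>\<alpha>\<bar> * fiber_norm E v"
proof -
  have "(fiber_norm E (fiber_scale E \<alpha> v))\<^sup>2 = (\<bar>\<alpha>\<bar> * fiber_norm E v)\<^sup>2"
    unfolding power_mult_distrib norm_sq sum_distrib_left
  proof (rule sum.cong)
    fix a assume "a \<in> charts E"
    then show "compl_dist (proj E (fiber_scale E \<alpha> v)) (chart_dom E a) *
        (norm (snd (chart E a (fiber_scale E \<alpha> v))))\<^sup>2 =
        \<bar>\<alpha>\<bar>\<^sup>2 * (compl_dist (proj E v) (chart_dom E a) * (norm (snd (chart E a v)))\<^sup>2)"
      \<comment> \<open>Outside its domain a chart has unspecified values, but there its weight is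
        \<open>0\<close>, and scaling keeps the base point.\<close>
      by (cases "proj E v \<in> chart_dom E a")
         (auto simp: chart_scale compl_dist_eq_0 power_mult_distrib)
  qed simp
  then show ?thesis by (simp add: power2_eq_iff_nonneg)
qed

text \<open>Being the zero vector of a fiber is expressed as being fixed by the factor
  \<open>0\<close>. A chart around the base point has positive weight, so its summand forces the
  coordinate to vanish.\<close>

lemma norm_eq_0:
  assumes "fiber_norm E v = 0"
  shows "fiber_scale E 0 v = v"
proof -
  obtain a where a: "a \<in> charts E" "proj E v \<in> chart_dom E a" using ex_chart by auto
  have "snd (chart E a v) = 0"
    using norm_sq_ge[OF a(1), of v] assms compl_dist_pos[OF open_dom[OF a(1)] a(2)]
    by (auto simp: mult_le_0_iff)
  then show ?thesis
    using fiber_scale_chart[OF a, of 0] chart_eq_iff[OF a] chart_inv_chart[OF a] by simp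
qed

text \<open>At the frontier of \<open>over E a\<close> the weight of the summand for \<open>a\<close> tends to \<open>0\<close>, and the extension
  of the chart to the closure keeps the other factor bounded there.\<close>

lemma continuous_fiber_norm: "continuous_on UNIV (fiber_norm E)"
proof -
  have "continuous_on UNIV
    (\<lambda>v. compl_dist (proj E v) (chart_dom E a) * (norm (snd (chart E a v)))\<^sup>2)" (is "continuous_on _ ?f")
    if a: "a \<in> charts E" for a
  proof -
    obtain f g where h: "homeomorphism (closure (over E a)) (closure (chart_dom E a) \<times> UNIV) f g"
      and fv: "\<And>v. v \<in> over E a \<Longrightarrow> f v = chart E a v"
      using chart_extends[OF a] by blast
    have out: "?f v = 0" if "v \<notin> over E a" for v
      using that by (simp add: over_def compl_dist_eq_0)
    have "continuous_on (closure (over E a)) f" using h by (auto simp: homeomorphism_def)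
    then have "continuous_on (closure (over E a))
        (\<lambda>v. compl_dist (proj E v) (chart_dom E a) * (norm (snd (f v)))\<^sup>2)"
      by (intro continuous_intros continuous_on_compose2[OF continuous_compl_dist]
          continuous_on_subset[OF cont_proj]) auto
    \<comment> \<open>On the frontier \<open>f\<close> may differ from the chart, but the weight is
      \<open>0\<close> there.\<close>
    then have 1: "continuous_on (closure (over E a)) ?f"
      by (rule continuous_on_eq) (metis (no_types, lifting) fv over_def vimageI2 compl_dist_eq_0 mult_zero_left vimage_eq)
    have 2: "continuous_on (- over E a) ?f"
      by (rule continuous_on_eq[of _ "\<lambda>_. 0"]) (auto simp: out)
    have "open (over E a)"
      using open_dom[OF a] cont_proj unfolding over_def by (intro open_vimage) auto
    then have "continuous_on (closure (over E a) \<union> - over E a) ?f"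
      using 1 2 by (intro continuous_on_closed_Un) (auto simp: closed_Compl)
    moreover have "closure (over E a) \<union> - over E a = UNIV" using closure_subset by auto
    ultimately show ?thesis by simp
  qed
  then have "continuous_on UNIV (\<lambda>v. sqrt ((fiber_norm E v)\<^sup>2))"
    unfolding norm_sq by (intro continuous_on_real_sqrt continuous_on_sum)
  then show ?thesis by simp
qed

text \<open>On the compact set \<open>K a\<close> the weight of chart \<open>a\<close> is at least
  \<open>\<eta>\<close>, so unit vectors over it have coordinates of norm at most
  \<open>1 / sqrt \<eta>\<close>. The sphere bundle is thus a finite union of continuous images of
  compact sets.\<close>

lemma compact_sphere: "compact (sphere_bundle (fiber_norm E))"
proof -
  let ?m = "\<lambda>b. \<Sum>a\<in>charts E. compl_dist b (chart_dom E a)"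
  have "continuous_on UNIV ?m" by (intro continuous_intros continuous_compl_dist)
  then obtain b0 where b0: "\<And>b. ?m b0 \<le> ?m b"
    using continuous_attains_inf[OF compact_base, of ?m] by auto
  obtain a0 where "a0 \<in> charts E" "b0 \<in> chart_dom E a0" using ex_chart by auto
  then have "0 < ?m b0"
    using finite_charts compl_dist_pos[OF open_dom] by (intro sum_pos2[of _ a0]) auto
  \<comment> \<open>This is half the average weight at the point where the sum of the weights is
    minimal; if all weights at some point were below it, their sum would be below the
    minimum.\<close>
  define \<eta> where "\<eta> = ?m b0 / (2 * real (card (charts E)))"
  have ch: "0 < card (charts E)" using \<open>a0 \<in> charts E\<close> finite_charts card_gt_0_iff by blast
  have \<eta>: "0 < \<eta>" using \<open>0 < ?m b0\<close> ch by (simp add: \<eta>_def)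
  define K where "K a = {b. \<eta> \<le> compl_dist b (chart_dom E a)}" for a
  have Kc: "compact (K a)" for a
  proof -
    have "closed (K a)" unfolding K_def
      by (intro closed_Collect_le continuous_compl_dist continuous_intros)
    then show ?thesis using compact_Int_closed[OF compact_base] by simp
  qed
  have Kd: "K a \<subseteq> chart_dom E a" for a
    using \<eta> compl_dist_eq_0 unfolding K_def by fastforce
  have Kcov: "\<exists>a\<in>charts E. b \<in> K a" for b
  proof (rule ccontr)
    assume "\<not> ?thesis"
    then have "?m b \<le> (\<Sum>a\<in>charts E. \<eta>)"
      by (intro sum_mono) (auto simp: K_def not_le less_imp_le)
    then show False using b0[of b] \<open>0 < ?m b0\<close> ch by (simp add: \<eta>_def)
  qed
  let ?D = "\<lambda>a. K a \<times> cball (0::'h) (1 / sqrt \<eta>)"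
  let ?S = "\<lambda>a. chart_inv E a ` (?D a \<inter> (\<lambda>p. fiber_norm E (chart_inv E a p)) -` {1})"
  have c2: "continuous_on (?D a) (chart_inv E a)" if "a \<in> charts E" for a
    using chart_homeo[OF that] Kd[of a] by (auto simp: homeomorphism_def elim!: continuous_on_subset)
  have "compact (?S a)" if "a \<in> charts E" for a
  proof (rule compact_continuous_image)
    show "continuous_on (?D a \<inter> (\<lambda>p. fiber_norm E (chart_inv E a p)) -` {1}) (chart_inv E a)"
      using c2[OF that] by (rule continuous_on_subset) auto
    have "compact (?D a)" using Kc by (intro compact_Times) auto
    moreover have "closed (?D a \<inter> (\<lambda>p. fiber_norm E (chart_inv E a p)) -` {1})"
      using compact_imp_closed[OF \<open>compact (?D a)\<close>]
        continuous_on_compose2[OF continuous_fiber_norm c2[OF that]]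
      by (intro continuous_closed_preimage) auto
    ultimately show "compact (?D a \<inter> (\<lambda>p. fiber_norm E (chart_inv E a p)) -` {1})"
      using compact_Int_closed by fastforce
  qed
  then have "compact (\<Union>a\<in>charts E. ?S a)" using finite_charts by (intro compact_UN) auto
  moreover have "sphere_bundle (fiber_norm E) = (\<Union>a\<in>charts E. ?S a)"
  proof (intro subset_antisym subsetI)
    fix v assume v: "v \<in> sphere_bundle (fiber_norm E)"
    obtain a where a: "a \<in> charts E" "proj E v \<in> K a" using Kcov by auto
    have d: "proj E v \<in> chart_dom E a" using a Kd by auto
    have "\<eta> * (norm (snd (chart E a v)))\<^sup>2 \<le> compl_dist (proj E v) (chart_dom E a) * (norm (snd (chart E a v)))\<^sup>2"
      using a by (intro mult_right_mono) (auto simp: K_def)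
    also have "\<dots> \<le> 1" using norm_sq_ge[OF a(1), of v] v by (simp add: sphere_bundle_def)
    finally have "(norm (snd (chart E a v)))\<^sup>2 \<le> (1 / sqrt \<eta>)\<^sup>2"
      using \<eta> by (simp add: power_divide field_simps)
    then have "norm (snd (chart E a v)) \<le> 1 / sqrt \<eta>"
      using \<eta> by (simp add: power2_le_iff_abs_le)
    then have "chart E a v \<in> ?D a" using a fst_chart[OF a(1) d] by (auto simp: mem_Times_iff)
    moreover have "v = chart_inv E a (chart E a v)" using a(1) d by simp
    ultimately show "v \<in> (\<Union>a\<in>charts E. ?S a)"
      using a(1) v unfolding sphere_bundle_def
      by (intro UN_I[OF a(1)] image_eqI[of _ _ "chart E a v"]) auto
  qed (auto simp: sphere_bundle_def)
  ultimately show ?thesis by simp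
qed

end


section \<open>Linear flows and the Poincare sphere\<close>

locale linear_flow_bundle = vec_bundle E
  for E :: "('v::topological_space, 'b::metric_space, 'h::euclidean_space, 'i) vbundle" +
  fixes \<Phi> :: "real \<Rightarrow> 'v \<Rightarrow> 'v"
  assumes flow: "linear_flow E \<Phi>"
begin

abbreviation "S \<equiv> sphere_bundle (fiber_norm E)"
abbreviation "S\<Phi> \<equiv> sphere_flow E (fiber_norm E) \<Phi>"
abbreviation "log_growth \<equiv> \<lambda>t v. ln (fiber_norm E (\<Phi> t v))"

lemma continuous_flow: "continuous_on UNIV (\<Phi> t)"
proof -
  have "continuous_on UNIV (\<lambda>(t, v). \<Phi> t v)"
    using flow by (auto simp: linear_flow_def continuous_flow_def)
  from continuous_on_compose2[OF this, of UNIV "\<lambda>v. (t, v)"] show ?thesis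
    by (simp add: continuous_intros)
qed

lemma flow_0: "\<Phi> 0 v = v"
  and flow_add: "\<Phi> (s + t) v = \<Phi> s (\<Phi> t v)"
  and flow_scale: "\<Phi> t (fiber_scale E \<alpha> v) = fiber_scale E \<alpha> (\<Phi> t v)"
  using flow by (auto simp: linear_flow_def continuous_flow_def)

text \<open>If the flow sent \<open>v\<close> to a zero vector, flowing back by \<open>- t\<close>,
  which commutes with the factor \<open>0\<close>, would make \<open>v\<close> a zero
  vector.\<close>

lemma norm_flow_pos:
  assumes "0 < fiber_norm E v"
  shows "0 < fiber_norm E (\<Phi> t v)"
proof (rule ccontr)
  assume "\<not> ?thesis"
  then have "fiber_norm E (\<Phi> t v) = 0" using fiber_norm_nonneg[of "\<Phi> t v"] by linarith
  then have "\<Phi> (- t) (fiber_scale E 0 (\<Phi> t v)) = \<Phi> (- t) (\<Phi> t v)" by (simp add: norm_eq_0)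
  then have "fiber_scale E 0 v = v" by (simp add: flow_scale flow_add[symmetric] flow_0)
  then have "fiber_norm E v = 0" using norm_scale[of 0 v] by simp
  then show False using assms by simp
qed

lemma sphere_flow_in_sphere: "v \<in> S \<Longrightarrow> S\<Phi> t v \<in> S"
  using norm_flow_pos[of v t] by (simp add: sphere_bundle_def sphere_flow_def)

text \<open>This is the flow in polar coordinates: for \<open>\<rho> > 0\<close>, the logarithm of
  the radius grows by \<open>log_growth t v\<close>, whatever the radius is.\<close>

lemma flow_eq_scaled_sphere_flow:
  "v \<in> S \<Longrightarrow> \<Phi> t (fiber_scale E \<rho> v) = fiber_scale E (\<rho> * fiber_norm E (\<Phi> t v)) (S\<Phi> t v)"
  using norm_flow_pos[of v t] by (simp add: sphere_bundle_def sphere_flow_def flow_scale)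

section \<open>Norm and flow on the Poincare sphere\<close>

lemma poincare_scale: "fiber_scale (poincare_bundle E) \<alpha> (v, r) = (fiber_scale E \<alpha> v, \<alpha> * r)"
proof -
  let ?P = "poincare_bundle E"
  define a where "a = chart_at E (proj E v)"
  have a: "a \<in> charts E" "proj E v \<in> chart_dom E a" using chart_at unfolding a_def by auto
  let ?w = "fiber_scale E \<alpha> v"
  \<comment> \<open>By injectivity the chosen inverse of the product chart is known as soon as one
    preimage over the chart domain is exhibited.\<close>
  have "inj_on (chart ?P a) (over ?P a)"
  proof (rule inj_onI)
    fix x y assume xy: "x \<in> over ?P a" "y \<in> over ?P a" and eq: "chart ?P a x = chart ?P a y"
    have "chart E a (fst x) = chart E a (fst y)" "snd x = snd y"
      using eq by (auto simp: poincare_bundle_def case_prod_unfold intro: prod_eqI)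
    moreover have "chart_inv E a (chart E a (fst x)) = fst x" "chart_inv E a (chart E a (fst y)) = fst y"
      using xy by (auto simp: poincare_bundle_def over_def case_prod_unfold a(1))
    ultimately show "x = y" by (metis prod_eqI)
  qed
  moreover have "(?w, \<alpha> * r) \<in> over ?P a" using a by (simp add: over_def poincare_bundle_def)
  moreover have "chart ?P a (?w, \<alpha> * r) = (proj E v, (\<alpha> *\<^sub>R snd (chart E a v), \<alpha> * r))"
    using a chart_scale[OF a] fst_chart[OF a(1), of ?w] by (simp add: poincare_bundle_def)
  ultimately have "chart_inv ?P a (proj E v, (\<alpha> *\<^sub>R snd (chart E a v), \<alpha> * r)) = (?w, \<alpha> * r)"
    unfolding chart_inv_def by (rule inv_into_f_eq)
  moreover have "chart_at ?P (proj E v) = a"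
    by (simp add: chart_at_def a_def poincare_bundle_def)
  ultimately show ?thesis
    by (simp add: fiber_scale_def[of ?P] Let_def) (simp add: poincare_bundle_def)
qed

lemma poincare_norm_eq: "poincare_norm E (v, r) = sqrt ((fiber_norm E v)\<^sup>2 + r\<^sup>2)"
  by (simp add: poincare_norm_def)

lemma poincare_norm_scale:
  "poincare_norm E (fiber_scale E \<alpha> v, \<alpha> * r) = \<bar>\<alpha>\<bar> * poincare_norm E (v, r)"
proof -
  have "(\<bar>\<alpha>\<bar> * fiber_norm E v)\<^sup>2 + (\<alpha> * r)\<^sup>2 = \<alpha>\<^sup>2 * ((fiber_norm E v)\<^sup>2 + r\<^sup>2)"
    by (simp add: power_mult_distrib algebra_simps)
  then show ?thesis by (simp add: poincare_norm_eq real_sqrt_mult)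
qed

lemma poincare_flow_eq:
  "poincare_flow E \<Phi> t (v, r) =
     (let n = poincare_norm E (\<Phi> t v, r) in (fiber_scale E (1 / n) (\<Phi> t v), r / n))"
  by (simp add: poincare_flow_def sphere_flow_def poincare_scale Let_def)

text \<open>A nonzero last coordinate is preserved by the flow; if it is zero, \<open>v\<close> is a
  nonzero vector and stays nonzero.\<close>

lemma poincare_norm_flow_pos:
  assumes "(v, r) \<in> poincare_sphere E"
  shows "0 < poincare_norm E (\<Phi> t v, r)"
proof (cases "r = 0")
  case True
  then have "0 < fiber_norm E v"
    using assms fiber_norm_nonneg[of v]
    by (auto simp: poincare_sphere_def sphere_bundle_def poincare_norm_eq less_le)
  then show ?thesis using norm_flow_pos[of v t] by (simp add: poincare_norm_eq sum_power2_gt_zero_iff)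
qed (simp add: poincare_norm_eq sum_power2_gt_zero_iff)

lemma poincare_flow_in_sphere:
  assumes "x \<in> poincare_sphere E"
  shows "poincare_flow E \<Phi> t x \<in> poincare_sphere E"
proof (cases x)
  case (Pair v r)
  have n: "0 < poincare_norm E (\<Phi> t v, r)" using poincare_norm_flow_pos assms Pair by simp
  then show ?thesis
    using poincare_norm_scale[of "1 / poincare_norm E (\<Phi> t v, r)" "\<Phi> t v" r] Pair
    by (simp add: poincare_flow_eq Let_def poincare_sphere_def sphere_bundle_def)
qed

lemma hemisphere_subset: "closed_upper_hemisphere E \<subseteq> poincare_sphere E"
  by (auto simp: closed_upper_hemisphere_def)

lemma poincare_flow_in_hemisphere:
  assumes "x \<in> closed_upper_hemisphere E"
  shows "poincare_flow E \<Phi> t x \<in> closed_upper_hemisphere E"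
proof (cases x)
  case (Pair v r)
  then have x: "(v, r) \<in> poincare_sphere E" "0 \<le> r"
    using assms by (auto simp: closed_upper_hemisphere_def)
  then show ?thesis
    using poincare_norm_flow_pos[OF x(1), of t] poincare_flow_in_sphere[OF x(1), of t] Pair
    by (auto simp: closed_upper_hemisphere_def poincare_flow_eq Let_def)
qed

lemma poincare_flow_add:
  assumes "x \<in> poincare_sphere E"
  shows "poincare_flow E \<Phi> (s + t) x = poincare_flow E \<Phi> s (poincare_flow E \<Phi> t x)"
proof (cases x)
  case (Pair v r)
  let ?n = "poincare_norm E (\<Phi> t v, r)"
  have n: "0 < ?n" using poincare_norm_flow_pos assms Pair by simp
  have "poincare_norm E (fiber_scale E (1 / ?n) (\<Phi> (s + t) v), r / ?n) =
      poincare_norm E (\<Phi> (s + t) v, r) / ?n"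
    using poincare_norm_scale[of "1 / ?n" "\<Phi> (s + t) v" r] n by simp
  then show ?thesis
    using n Pair by (simp add: poincare_flow_eq Let_def flow_scale flow_add)
qed

lemma continuous_poincare_norm: "continuous_on UNIV (poincare_norm E)"
  unfolding poincare_norm_def case_prod_unfold
  by (intro continuous_intros continuous_on_compose2[OF continuous_fiber_norm]) auto

lemma continuous_poincare_flow: "continuous_on (poincare_sphere E) (poincare_flow E \<Phi> t)"
proof -
  let ?n = "\<lambda>x. poincare_norm E (\<Phi> t (fst x), snd x)"
  have c: "continuous_on (poincare_sphere E) (\<lambda>x. \<Phi> t (fst x))"
    by (intro continuous_on_compose2[OF continuous_flow] continuous_intros) auto
  have n: "continuous_on (poincare_sphere E) ?n"
    by (intro continuous_on_compose2[OF continuous_poincare_norm] continuous_intros c) auto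
  have pos: "?n x \<noteq> 0" if "x \<in> poincare_sphere E" for x
    using poincare_norm_flow_pos[of "fst x" "snd x" t] that by simp
  have "continuous_on (poincare_sphere E) (\<lambda>x. case (1 / ?n x, \<Phi> t (fst x)) of (\<alpha>, v) \<Rightarrow> fiber_scale E \<alpha> v)"
    by (rule continuous_on_compose2[OF continuous_fiber_scale])
       (use pos in \<open>auto intro!: continuous_intros c n\<close>)
  then have "continuous_on (poincare_sphere E) (\<lambda>x. (fiber_scale E (1 / ?n x) (\<Phi> t (fst x)), snd x / ?n x))"
    using pos by (auto intro!: continuous_intros n)
  then show ?thesis
    by (rule continuous_on_eq) (auto simp: poincare_flow_eq Let_def)
qed

lemma poincare_proj_in_hemisphere: "poincare_proj E v \<in> closed_upper_hemisphere E"
proof -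
  have n: "0 < poincare_norm E (v, 1)" by (simp add: poincare_norm_eq add_nonneg_pos)
  then show ?thesis
    using poincare_norm_scale[of "1 / poincare_norm E (v, 1)" v 1]
    by (simp add: poincare_proj_def closed_upper_hemisphere_def poincare_sphere_def sphere_bundle_def)
qed

text \<open>The linear flow moves \<open>(v, 1)\<close> to \<open>(\<Phi> t v, 1)\<close>.
  Normalizing before flowing only changes this by a positive factor, which the final normalization
  removes.\<close>

lemma poincare_flow_proj: "poincare_flow E \<Phi> t (poincare_proj E v) = poincare_proj E (\<Phi> t v)"
proof -
  let ?n = "poincare_norm E (v, 1)"
  have n: "0 < ?n" by (simp add: poincare_norm_eq add_nonneg_pos)
  have "poincare_norm E (fiber_scale E (1 / ?n) (\<Phi> t v), 1 / ?n) = poincare_norm E (\<Phi> t v, 1) / ?n"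
    using poincare_norm_scale[of "1 / ?n" "\<Phi> t v" 1] n by simp
  then show ?thesis using n by (simp add: poincare_flow_eq poincare_proj_def Let_def flow_scale)
qed

lemma closedin_hemisphere: "closedin (top_of_set (poincare_sphere E)) (closed_upper_hemisphere E)"
proof -
  have "closed {x :: 'v \<times> real. 0 \<le> snd x}"
    by (intro closed_Collect_le continuous_intros)
  moreover have "closed_upper_hemisphere E = poincare_sphere E \<inter> {x. 0 \<le> snd x}"
    by (auto simp: closed_upper_hemisphere_def)
  ultimately show ?thesis by (auto simp: closedin_closed)
qed

end

section \<open>Lifting chains from the sphere bundle to the hemisphere\<close>

locale metrized_flow = linear_flow_bundle E \<Phi>
  for E :: "('v::topological_space, 'b::metric_space, 'h::euclidean_space, 'i) vbundle" and \<Phi> +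
  fixes dS :: "'v \<Rightarrow> 'v \<Rightarrow> real" and dP :: "'v \<times> real \<Rightarrow> 'v \<times> real \<Rightarrow> real"
  assumes dS_metric: "Metric_space S dS"
    and dS_top: "Metric_space.mtopology S dS = top_of_set S"
    and dP_metric: "Metric_space (poincare_sphere E) dP"
    and dP_top: "Metric_space.mtopology (poincare_sphere E) dP = top_of_set (poincare_sphere E)"
begin

text \<open>The point \<open>\<pi>\<^sub>P (\<rho> v)\<close> equals \<open>(s v, sqrt (1 - s\<^sup>2))\<close> with \<open>s = \<rho> / sqrt (1 + \<rho>\<^sup>2) \<in> [0, 1]\<close>, so
  uniformity in the unbounded parameter \<open>\<rho>\<close> comes from compactness of \<open>S \<times> [0, 1]\<close>.\<close>

lemma poincare_proj_uniform:
  assumes "0 < \<epsilon>"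
  obtains \<delta> where "0 < \<delta>"
    "\<And>v v' \<rho>. \<lbrakk>v \<in> S; v' \<in> S; 0 < \<rho>; dS v v' < \<delta>\<rbrakk> \<Longrightarrow>
       dP (poincare_proj E (fiber_scale E \<rho> v)) (poincare_proj E (fiber_scale E \<rho> v')) < \<epsilon>"
    "\<And>v \<rho> \<rho>'. \<lbrakk>v \<in> S; 0 < \<rho>; \<rho> < \<delta>; 0 < \<rho>'; \<rho>' < \<delta>\<rbrakk> \<Longrightarrow>
       dP (poincare_proj E (fiber_scale E \<rho> v)) (poincare_proj E (fiber_scale E \<rho>' v)) < \<epsilon>"
proof -
  interpret MS: Metric_space S dS by (fact dS_metric)
  interpret MI: Metric_space "{0..1::real}" dist by (simp add: Met_TC.subspace)
  interpret P: Metric_space12 S dS "{0..1::real}" dist ..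
  let ?Q = "\<lambda>(v, s :: real). (fiber_scale E s v, sqrt (1 - s\<^sup>2))"
  have I: "MI.mtopology = top_of_set {0..1}"
    using Submetric.mtopology_submetric[of UNIV dist "{0..1::real}"]
    by (simp add: Submetric_def Submetric_axioms_def Met_TC.Metric_space_axioms)
  have top: "P.Prod_metric.mtopology = top_of_set (S \<times> {0..1})"
    unfolding P.mtopology_prod_metric dS_top I by (simp add: prod_topology_subtopology_eu)
  have "compact (S \<times> {0..1::real})" by (intro compact_Times compact_sphere) simp
  then have comp: "compact_space P.Prod_metric.mtopology"
    unfolding top by (simp add: compact_space_subtopology)
  have cont: "continuous_on (S \<times> {0..1}) ?Q"
  proof -
    have "continuous_on (S \<times> {0..1}) (\<lambda>x. case (snd x, fst x) of (\<alpha>, v) \<Rightarrow> fiber_scale E \<alpha> v)"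
      by (rule continuous_on_compose2[OF continuous_fiber_scale]) (auto intro!: continuous_intros)
    then show ?thesis unfolding case_prod_unfold by (auto intro!: continuous_intros)
  qed
  have im: "?Q x \<in> poincare_sphere E" if "x \<in> S \<times> {0..1}" for x
    using that by (auto simp: poincare_sphere_def sphere_bundle_def poincare_norm_eq power_le_one)
  have "continuous_map P.Prod_metric.mtopology (Metric_space.mtopology (poincare_sphere E) dP) ?Q"
    unfolding top dP_top using cont im by (auto simp: continuous_map_in_subtopology)
  from Heine_Cantor_metric[OF P.prod_metric dP_metric comp this assms]
  obtain \<delta> where \<delta>: "0 < \<delta>"
    "\<And>x y. \<lbrakk>x \<in> S \<times> {0..1}; y \<in> S \<times> {0..1}; prod_dist dS dist x y < \<delta>\<rbrakk> \<Longrightarrow> dP (?Q x) (?Q y) < \<epsilon>"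
    by blast
  let ?s = "\<lambda>\<rho>. \<rho> / sqrt (1 + \<rho>\<^sup>2)"
  \<comment> \<open>The bound by \<open>\<rho>\<close> makes small radii have small parameters
    \<open>s\<close>.\<close>
  have s01: "?s \<rho> \<in> {0..1}" "0 < ?s \<rho>" "?s \<rho> \<le> \<rho>" if "0 < \<rho>" for \<rho> :: real
  proof -
    have "1 \<le> sqrt (1 + \<rho>\<^sup>2)" by simp
    moreover have "\<rho> \<le> sqrt (1 + \<rho>\<^sup>2)" by (rule real_le_rsqrt) simp
    moreover have pos: "0 < sqrt (1 + \<rho>\<^sup>2)" by (simp add: add_pos_nonneg)
    ultimately show "?s \<rho> \<in> {0..1}" "0 < ?s \<rho>" "?s \<rho> \<le> \<rho>"
      using that mult_left_mono[of 1 "sqrt (1 + \<rho>\<^sup>2)" \<rho>] by (auto simp: divide_le_eq)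
  qed
  have Q: "poincare_proj E (fiber_scale E \<rho> v) = ?Q (v, ?s \<rho>)" if "v \<in> S" for v and \<rho> :: real
  proof -
    have p: "0 < 1 + \<rho>\<^sup>2" by (simp add: add_pos_nonneg)
    have "1 - (?s \<rho>)\<^sup>2 = 1 / (1 + \<rho>\<^sup>2)" using p by (simp add: power_divide field_simps)
    then have "sqrt (1 - (?s \<rho>)\<^sup>2) = 1 / sqrt (1 + \<rho>\<^sup>2)" by (simp add: real_sqrt_divide)
    then show ?thesis
      using that by (simp add: poincare_proj_def poincare_norm_eq sphere_bundle_def power_mult_distrib add.commute)
  qed
  show ?thesis
  proof
    fix v v' and \<rho> :: real assume h: "v \<in> S" "v' \<in> S" "0 < \<rho>" "dS v v' < \<delta>"
    have "prod_dist dS dist (v, ?s \<rho>) (v', ?s \<rho>) < \<delta>"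
      using P.prod_metric_le_components[OF h(1,2) s01(1) s01(1), OF h(3) h(3)] h(4) by simp
    then show "dP (poincare_proj E (fiber_scale E \<rho> v)) (poincare_proj E (fiber_scale E \<rho> v')) < \<epsilon>"
      using \<delta>(2)[of "(v, ?s \<rho>)" "(v', ?s \<rho>)"] h s01 Q by simp
  next
    fix v \<rho> \<rho>' assume h: "v \<in> S" "0 < \<rho>" "\<rho> < \<delta>" "0 < \<rho>'" "\<rho>' < \<delta>"
    \<comment> \<open>Both parameters lie strictly between \<open>0\<close> and
      \<open>\<delta>\<close>.\<close>
    have "dist (?s \<rho>) (?s \<rho>') < \<delta>"
      using s01(2,3)[OF h(2)] s01(2,3)[OF h(4)] h by (simp add: dist_real_def)
    then have "prod_dist dS dist (v, ?s \<rho>) (v, ?s \<rho>') < \<delta>"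
      using P.prod_metric_le_components[OF h(1,1) s01(1) s01(1), OF h(2) h(4)] h(1) by simp
    then show "dP (poincare_proj E (fiber_scale E \<rho> v)) (poincare_proj E (fiber_scale E \<rho>' v)) < \<epsilon>"
      using \<delta>(2)[of "(v, ?s \<rho>)" "(v, ?s \<rho>')"] h s01 Q by simp
  qed (fact \<delta>(1))
qed

text \<open>In the lifted chain a jump changes only the direction and keeps the radius reached by
  the flow. The bound from \<open>\<delta>\<close> is uniform in the radius, so it applies to every
  jump, while the radius picks up the factors \<open>exp (log_growth t u)\<close>.\<close>

lemma lift_chain:
  assumes c: "chain_to S dS S\<Phi> log_growth \<delta> T x y g" and "0 < \<rho>"
    and \<delta>: "\<And>v v' \<rho>. \<lbrakk>v \<in> S; v' \<in> S; 0 < \<rho>; dS v v' < \<delta>\<rbrakk> \<Longrightarrow>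
       dP (poincare_proj E (fiber_scale E \<rho> v)) (poincare_proj E (fiber_scale E \<rho> v')) < \<epsilon>"
  shows "chain_to (closed_upper_hemisphere E) dP (poincare_flow E \<Phi>) (\<lambda>_ _. 0) \<epsilon> T
    (poincare_proj E (fiber_scale E \<rho> x)) (poincare_proj E (fiber_scale E (\<rho> * exp g) y)) 0"
proof -
  have step: "dP (poincare_flow E \<Phi> t (poincare_proj E (fiber_scale E \<sigma> u)))
      (poincare_proj E (fiber_scale E (\<sigma> * exp (log_growth t u)) z)) < \<epsilon>"
    if "u \<in> S" "z \<in> S" "dS (S\<Phi> t u) z < \<delta>" "0 < \<sigma>" for t u z \<sigma>
  proof -
    have "0 < fiber_norm E (\<Phi> t u)" using that(1) norm_flow_pos by (simp add: sphere_bundle_def)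
    then show ?thesis
      using \<delta>[OF sphere_flow_in_sphere[OF that(1)] that(2) _ that(3), of "\<sigma> * fiber_norm E (\<Phi> t u)"] that
      by (simp add: poincare_flow_proj flow_eq_scaled_sphere_flow)
  qed
  show ?thesis
    using c
  proof induction
    case (single y t)
    show ?case
      by (rule chain_to.single[where w = "\<lambda>_ _. 0" and d = dP and \<Psi> = "poincare_flow E \<Phi>", OF poincare_proj_in_hemisphere
            poincare_proj_in_hemisphere single(3) step[OF single(1,2,4) \<open>0 < \<rho>\<close>]])
  next
    case (snoc y g z t)
    have "y \<in> S" using chain_to_in_space[OF snoc(1)] by simp
    from chain_to.snoc[OF snoc.IH poincare_proj_in_hemisphere snoc(3)
        step[OF this snoc(2,4), of "\<rho> * exp g"]] \<open>0 < \<rho>\<close>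
    show ?case by (simp add: exp_add mult.assoc)
  qed
qed

text \<open>The chain realizing the exponent \<open>l\<close> is arbitrarily long, while its end points can be joined
  to \<open>p\<close> and \<open>q\<close> by chains from a fixed finite collection, obtained from a finite net of \<open>M\<close>.\<close>

lemma chain_with_large_growth:
  assumes M: "chain_transitive S dS S\<Phi> M" and l: "l \<in> morse_spectrum E \<Phi> dS M" and \<sigma>l: "0 < \<sigma> * l"
    and "0 < \<epsilon>" "0 < T" and pq: "p \<in> M" "q \<in> M"
  obtains g where "R \<le> \<sigma> * g" "chain_to S dS S\<Phi> log_growth \<epsilon> T p q g"
proof -
  interpret MS: Metric_space S dS by (fact dS_metric)
  let ?chain = "chain_to S dS S\<Phi> log_growth"
  have MS: "M \<subseteq> S" using M by (simp add: chain_transitive_def)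
  have "compactin MS.mtopology S"
    unfolding dS_top using compact_sphere by (simp add: compactin_subtopology)
  then have "MS.mtotally_bounded M"
    using MS.compactin_imp_mtotally_bounded MS.mtotally_bounded_subset MS by blast
  from this[unfolded MS.mtotally_bounded_def, rule_format, OF half_gt_zero[OF \<open>0 < \<epsilon>\<close>]]
  obtain K where K: "finite K" "K \<subseteq> M" "M \<subseteq> (\<Union>x\<in>K. MS.mball x (\<epsilon> / 2))"
    by auto
  have net: "\<exists>c\<in>K. dS c x < \<epsilon> / 2" if "x \<in> M" for x
  proof -
    obtain c where "c \<in> K" "x \<in> MS.mball c (\<epsilon> / 2)" using K(3) \<open>x \<in> M\<close> by blast
    then show ?thesis by (intro bexI[of _ c]) simp_all
  qed
  have conn: "\<exists>g. ?chain (\<epsilon> / 2) T x y g" if "x \<in> M" "y \<in> M" for x y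
  proof -
    have "y \<in> chain_limit_set S dS S\<Phi> x" using M that by (auto simp: chain_transitive_def)
    then show ?thesis
      using \<open>0 < \<epsilon>\<close> \<open>0 < T\<close> half_gt_zero[of \<epsilon>] unfolding chain_limit_set_iff[where w = log_growth] by simp
  qed
  obtain gp where gp: "\<And>c. c \<in> M \<Longrightarrow> ?chain (\<epsilon> / 2) T p c (gp c)" using conn[OF pq(1)] by metis
  obtain gq where gq: "\<And>c. c \<in> M \<Longrightarrow> ?chain (\<epsilon> / 2) T c q (gq c)" using conn[OF _ pq(2)] by metis
  \<comment> \<open>\<open>C\<close> bounds the effect of a connecting chain at either end, whatever
    its sign; it depends on the net but not on \<open>k\<close>.\<close>
  define C where "C = (\<Sum>c\<in>K. \<bar>\<sigma> * gp c\<bar> + \<bar>\<sigma> * gq c\<bar>)"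
  have C: "\<bar>\<sigma> * gp c\<bar> + \<bar>\<sigma> * gq c\<bar> \<le> C" if "c \<in> K" for c
    unfolding C_def using that K(1) by (intro member_le_sum) auto
  from l obtain \<epsilon>' T' n \<tau> x where
    \<epsilon>': "\<epsilon>' \<longlonglongrightarrow> (0 :: real)" and T': "filterlim T' at_top sequentially"
    and ch: "\<And>k. is_chain S dS S\<Phi> (\<epsilon>' k) (T' k) (n k) (\<tau> k) (x k)"
    and xM: "\<And>k i. i \<le> n k \<Longrightarrow> x k i \<in> M"
    and lim: "(\<lambda>k. chain_exponent (fiber_norm E) \<Phi> (n k) (\<tau> k) (x k)) \<longlonglongrightarrow> l"
    unfolding morse_spectrum_def by blast
  let ?e = "\<lambda>k. chain_exponent (fiber_norm E) \<Phi> (n k) (\<tau> k) (x k)"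
  \<comment> \<open>The factor \<open>\<sigma>\<close> carries the sign of \<open>l\<close>, so
    positive and negative exponents are treated as one lower bound.\<close>
  have "(\<lambda>k. \<sigma> * ?e k) \<longlonglongrightarrow> \<sigma> * l" using lim by (intro tendsto_intros)
  then have "\<forall>\<^sub>F k in sequentially. \<sigma> * l / 2 < \<sigma> * ?e k"
    by (rule order_tendstoD) (use \<sigma>l in simp)
  moreover have "\<forall>\<^sub>F k in sequentially. \<epsilon>' k < \<epsilon> / 2"
    using \<epsilon>' by (rule order_tendstoD) (use \<open>0 < \<epsilon>\<close> in simp)
  \<comment> \<open>With exponent above \<open>\<sigma> * l / 2\<close> after multiplication by
    \<open>\<sigma>\<close>, this total time yields growth \<open>R + 2 * C\<close>, enough to pay
    for both connecting chains.\<close>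
  moreover have "\<forall>\<^sub>F k in sequentially. max T (2 * (R + 2 * C) / (\<sigma> * l)) \<le> T' k"
    using T' unfolding filterlim_at_top by (rule spec)
  ultimately have "\<forall>\<^sub>F k in sequentially. \<sigma> * l / 2 < \<sigma> * ?e k \<and> \<epsilon>' k < \<epsilon> / 2 \<and>
      T \<le> T' k \<and> 2 * (R + 2 * C) / (\<sigma> * l) \<le> T' k"
    by eventually_elim simp
  from eventually_happens'[OF sequentially_bot this]
  obtain k where k: "\<sigma> * l / 2 < \<sigma> * ?e k" "\<epsilon>' k < \<epsilon> / 2" "T \<le> T' k"
      "2 * (R + 2 * C) / (\<sigma> * l) \<le> T' k"
    by auto
  define G where "G = (\<Sum>i<n k. log_growth (\<tau> k i) (x k i))"
  have nk: "1 \<le> n k" "0 < T' k" "\<And>i. i < n k \<Longrightarrow> T' k \<le> \<tau> k i" using ch[of k] by (auto simp: is_chain_def)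
  have "1 * T' k \<le> real (n k) * T' k" using nk by (intro mult_right_mono) auto
  also have "\<dots> \<le> (\<Sum>i<n k. \<tau> k i)" using sum_mono[of "{..<n k}" "\<lambda>_. T' k" "\<tau> k"] nk(3) by simp
  finally have tot: "T' k \<le> (\<Sum>i<n k. \<tau> k i)" by simp
  have "R + 2 * C \<le> \<sigma> * l / 2 * T' k" using k(4) \<sigma>l by (simp add: field_simps)
  also have "\<dots> \<le> \<sigma> * ?e k * (\<Sum>i<n k. \<tau> k i)" using k(1) tot nk(2) \<sigma>l by (intro mult_mono) auto
  also have "\<dots> = \<sigma> * G" using tot nk(2) by (simp add: chain_exponent_def G_def)
  finally have G: "R + 2 * C \<le> \<sigma> * G" .
  obtain c where c: "c \<in> K" "dS c (x k 0) < \<epsilon> / 2" using net[OF xM[of 0 k]] by auto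
  obtain c' where c': "c' \<in> K" "dS c' (x k (n k)) < \<epsilon> / 2" using net[OF xM[of "n k" k]] by auto
  note perturb = chain_to_perturb[OF dS_metric sphere_flow_in_sphere]
  \<comment> \<open>The connecting chain ends at the net point \<open>c\<close>; its last jump is
    redirected to \<open>x k 0\<close>.\<close>
  have 1: "?chain \<epsilon> T p (x k 0) (gp c)"
    using gp[of c] c K(2) xM[of 0 k] MS by - (rule perturb, auto)
  have "?chain (\<epsilon> / 2) T (x k 0) (x k (n k)) G"
    unfolding G_def by (rule chain_to_mono[OF is_chain_imp_chain_to[OF ch]]) (use k in auto)
  then have 2: "?chain \<epsilon> T (x k 0) c' G"
    using c' K(2) MS MS.commute[of c' "x k (n k)"] by - (rule perturb, auto)
  have 3: "?chain \<epsilon> T c' q (gq c')"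
    by (rule chain_to_mono[OF gq]) (use c'(1) K(2) \<open>0 < \<epsilon>\<close> in auto)
  have "?chain \<epsilon> T p q (gp c + (G + gq c'))"
    by (rule chain_to_trans[OF chain_to_trans[OF 3 2] 1])
  moreover have "R \<le> \<sigma> * (gp c + (G + gq c'))"
    using G C[OF c(1)] C[OF c'(1)] by (simp add: distrib_left)
  ultimately show ?thesis using that by blast
qed

section \<open>Chain transitivity of the projected cone and of its closure\<close>

lemma chain_transitive_poincare_cone:
  assumes M: "chain_transitive S dS S\<Phi> M"
    and neg: "l \<in> morse_spectrum E \<Phi> dS M" "l < 0"
    and pos: "l' \<in> morse_spectrum E \<Phi> dS M" "0 < l'"
  shows "chain_transitive (closed_upper_hemisphere E) dP (poincare_flow E \<Phi>)
    (poincare_proj E ` cone_bundle E M)"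
proof -
  let ?X = "closed_upper_hemisphere E"
  let ?J = "\<lambda>\<rho> v. poincare_proj E (fiber_scale E \<rho> v)"
  let ?chain = "chain_to ?X dP (poincare_flow E \<Phi>) (\<lambda>_ _. 0)"
  have X: "Metric_space ?X dP"
    using Metric_space.subspace[OF dP_metric hemisphere_subset] .
  have conn: "?chain \<epsilon> T (?J \<rho> p) (?J \<rho>' q) 0"
    if a: "p \<in> M" "q \<in> M" "0 < \<rho>" "0 < \<rho>'" "0 < \<epsilon>" "0 < T" for p q \<rho> \<rho>' \<epsilon> T
  proof -
    have pS: "p \<in> S" using a(1) M by (auto simp: chain_transitive_def)
    \<comment> \<open>The same \<open>\<delta>\<close> bounds the jumps of the chains to be lifted
      and the radii near the zero section.\<close>
    obtain \<delta> where \<delta>: "0 < \<delta>"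
      "\<And>v v' \<rho>. \<lbrakk>v \<in> S; v' \<in> S; 0 < \<rho>; dS v v' < \<delta>\<rbrakk> \<Longrightarrow> dP (?J \<rho> v) (?J \<rho> v') < \<epsilon> / 2"
      "\<And>v \<rho> \<rho>'. \<lbrakk>v \<in> S; 0 < \<rho>; \<rho> < \<delta>; 0 < \<rho>'; \<rho>' < \<delta>\<rbrakk> \<Longrightarrow> dP (?J \<rho> v) (?J \<rho>' v) < \<epsilon> / 2"
      using poincare_proj_uniform[of "\<epsilon> / 2"] a(5) by auto
    \<comment> \<open>The summand \<open>1\<close> gives the strict inequality
      \<open>g < ln (\<delta> / \<rho>)\<close>, so the descent ends at a radius below
      \<open>\<delta>\<close>; likewise for \<open>h\<close> and the radius where the ascent
      starts.\<close>
    obtain g where g: "1 - ln (\<delta> / \<rho>) \<le> - 1 * g" "chain_to S dS S\<Phi> log_growth \<delta> T p p g"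
      using chain_with_large_growth[OF M neg(1) _ \<delta>(1) a(6,1,1), of "- 1" "1 - ln (\<delta> / \<rho>)"] neg(2) by auto
    obtain h where h: "1 - ln (\<delta> / \<rho>') \<le> 1 * h" "chain_to S dS S\<Phi> log_growth \<delta> T p q h"
      using chain_with_large_growth[OF M pos(1) _ \<delta>(1) a(6,1,2), of 1 "1 - ln (\<delta> / \<rho>')"] pos(2) by auto
    have "exp g < exp (ln (\<delta> / \<rho>))" using g(1) by simp
    then have small: "\<rho> * exp g < \<delta>" using a(3) \<delta>(1) by (simp add: field_simps)
    have "exp (- h) < exp (ln (\<delta> / \<rho>'))" using h(1) by simp
    then have small': "\<rho>' * exp (- h) < \<delta>" using a(4) \<delta>(1) by (simp add: field_simps)
    have "?chain (\<epsilon> / 2) T (?J \<rho> p) (?J (\<rho> * exp g) p) 0"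
      by (rule lift_chain[OF g(2) a(3) \<delta>(2)])
    moreover have "dP (?J (\<rho> * exp g) p) (?J (\<rho>' * exp (- h)) p) < \<epsilon> / 2"
      using small small' a by (intro \<delta>(3) pS) auto
    \<comment> \<open>The change of radius is merged into the last jump of the descent, each using
      half of \<open>\<epsilon>\<close>.\<close>
    ultimately have 1: "?chain \<epsilon> T (?J \<rho> p) (?J (\<rho>' * exp (- h)) p) 0"
      using poincare_proj_in_hemisphere
      by - (rule chain_to_perturb[OF X poincare_flow_in_hemisphere], auto)
    have "?chain (\<epsilon> / 2) T (?J (\<rho>' * exp (- h)) p) (?J (\<rho>' * exp (- h) * exp h) q) 0"
      using a(4) by (intro lift_chain[OF h(2) _ \<delta>(2)]) auto
    then have "?chain (\<epsilon> / 2) T (?J (\<rho>' * exp (- h)) p) (?J \<rho>' q) 0"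
      by (simp add: mult.assoc exp_add[symmetric])
    then have 2: "?chain \<epsilon> T (?J (\<rho>' * exp (- h)) p) (?J \<rho>' q) 0"
      by (rule chain_to_mono) (use a(5) in auto)
    show ?thesis using chain_to_trans[OF 2 1] by simp
  qed
  show ?thesis
    unfolding chain_transitive_def chain_limit_set_iff[where w = "\<lambda>_ _. 0"]
  proof (intro conjI ballI allI impI)
    fix x y and \<epsilon> T :: real
    assume "x \<in> poincare_proj E ` cone_bundle E M" "y \<in> poincare_proj E ` cone_bundle E M"
    then obtain p q \<rho> \<rho>' where "p \<in> M" "q \<in> M" "0 < \<rho>" "0 < \<rho>'" "x = ?J \<rho> p" "y = ?J \<rho>' q"
      by (auto simp: cone_bundle_def)
    moreover assume "0 < \<epsilon>" "0 < T"
    ultimately show "\<exists>g. ?chain \<epsilon> T x y g" using conn by blast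
  qed (auto intro: poincare_proj_in_hemisphere)
qed

end

theorem theorem4p7:
  fixes E :: "('v::topological_space, 'b::metric_space, 'h::euclidean_space, 'i) vbundle"
    and \<Phi> :: "real \<Rightarrow> 'v \<Rightarrow> 'v"
    and dS :: "'v \<Rightarrow> 'v \<Rightarrow> real"
    and dP :: "'v \<times> real \<Rightarrow> 'v \<times> real \<Rightarrow> real"
    and M :: "'v set"
  assumes vb: "vector_bundle E"
    and flow: "linear_flow E \<Phi>"
    and base: "chain_transitive UNIV dist (base_flow E \<Phi>) (UNIV :: 'b set)"
    and dS_metric: "Metric_space (sphere_bundle (fiber_norm E)) dS"
    and dS_top: "Metric_space.mtopology (sphere_bundle (fiber_norm E)) dS
                   = top_of_set (sphere_bundle (fiber_norm E))"
    and dP_metric: "Metric_space (poincare_sphere E) dP"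
    and dP_top: "Metric_space.mtopology (poincare_sphere E) dP = top_of_set (poincare_sphere E)"
    and component: "chain_recurrent_component (sphere_bundle (fiber_norm E)) dS
                      (sphere_flow E (fiber_norm E) \<Phi>) M"
    and spectrum: "0 \<in> interior (morse_spectrum E \<Phi> dS M)"
  shows "chain_transitive (closed_upper_hemisphere E) dP (poincare_flow E \<Phi>)
           (top_of_set (poincare_sphere E) closure_of (poincare_proj E ` cone_bundle E M))"
proof -
  interpret metrized_flow E \<Phi> dS dP
    by (intro metrized_flow.intro linear_flow_bundle.intro vec_bundle.intro
        linear_flow_bundle_axioms.intro metrized_flow_axioms.intro)
      (fact vb flow dS_metric dS_top dP_metric dP_top)+
  obtain r where r: "0 < r" "ball 0 r \<subseteq> morse_spectrum E \<Phi> dS M"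
    using spectrum by (auto simp: mem_interior)
  \<comment> \<open>A ball around \<open>0\<close> contains exponents of both signs.\<close>
  have mem: "- r / 2 \<in> morse_spectrum E \<Phi> dS M" "r / 2 \<in> morse_spectrum E \<Phi> dS M"
    using r by (auto simp: subset_iff)
  have trans: "chain_transitive (closed_upper_hemisphere E) dP (poincare_flow E \<Phi>)
      (poincare_proj E ` cone_bundle E M)"
    using component mem r(1)
    by (intro chain_transitive_poincare_cone[of M "- r / 2" "r / 2"])
       (auto simp: chain_recurrent_component_def)
  have sub: "poincare_proj E ` cone_bundle E M \<subseteq> closed_upper_hemisphere E"
    using poincare_proj_in_hemisphere by blast
  have "continuous_map (Metric_space.mtopology (poincare_sphere E) dP)
      (Metric_space.mtopology (poincare_sphere E) dP) (poincare_flow E \<Phi> t)" for t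
    unfolding dP_top using continuous_poincare_flow poincare_flow_in_sphere
    by (auto simp: continuous_map_in_subtopology)
  then have "chain_transitive (closed_upper_hemisphere E) dP (poincare_flow E \<Phi>)
      (Metric_space.mtopology (poincare_sphere E) dP closure_of (poincare_proj E ` cone_bundle E M))"
    \<comment> \<open>The hemisphere is closed in the Poincare sphere, so the closure of the
      projected cone stays inside it.\<close>
    using closure_of_minimal[OF sub closedin_hemisphere] trans hemisphere_subset
    by (intro chain_transitive_closure[OF dP_metric hemisphere_subset sub])
       (auto simp: dP_top intro: poincare_flow_in_hemisphere poincare_flow_add)
  then show ?thesis by (simp add: dP_top)
qed

end
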